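(* Let $(A,\cdot)$ be an anti-flexible algebra over a field $\mathbb{K}$ of characteristic different from $2$, let $\lambda\in\mathbb{K}$, and let $R_B:A\to A$ be a Rota-Baxter operator of weight $\lambda$ on $A$. Define, for all $a,b\in A$, $$a\prec b=a\cdot R_B(b)+\tfrac{\lambda}{2}\,a\cdot b,\qquad a\succ b=R_B(a)\cdot b+\tfrac{\lambda}{2}\,a\cdot b.$$ Then $(A,\prec,\succ)$ is a pre-anti-flexible algebra if and only if $$\lambda^2\big((a\cdot b)\cdot c+c\cdot(b\cdot a)\big)=0\quad\text{for all } a,b,c\in A.$$
   Context: An anti-flexible algebra is a $\mathbb{K}$-vector space $A$ with a bilinear product $\cdot$ such that $(x\cdot y)\cdot z-x\cdot(y\cdot z)=(z\cdot y)\cdot x-z\cdot(y\cdot x)$ for all $x,y,z\in A$. A Rota-Baxter operator of weight $\lambda\in\mathbb{K}$ on an anti-flexible algebra $(A,\cdot)$ is a linear map $R_B:A\to A$ with $R_B(a)\cdot R_B(b)=R_B(a\cdot R_B(b)+R_B(a)\cdot b)+\lambda R_B(a\cdot b)$ for all $a,b\in A$. A pre-anti-flexible algebra is a vector space $A$ with two bilinear products $\prec,\succ$ such that for all $x,y,z\in A$: (i) $(x\succ y)\prec z-x\succ(y\prec z)=(z\succ y)\prec x-z\succ(y\prec x)$; (ii) $(x\succ y+x\prec y)\succ z-x\succ(y\succ z)=(z\prec y)\prec x-z\prec(y\prec x+y\succ x)$. *)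

theory Defs
  imports Complex_Main
begin

text \<open>
  The underlying vector space is the whole type \<open>'a\<close>, of arbitrary dimension, over the field \<open>'k\<close>.
\<close>

locale bilinear_product = vector_space scale
  for scale :: "'k::field \<Rightarrow> 'a::ab_group_add \<Rightarrow> 'a" +
  fixes mult :: "'a \<Rightarrow> 'a \<Rightarrow> 'a"  (infixl "\<cdot>" 70)
  assumes linear_in_left: "Vector_Spaces.linear scale scale (\<lambda>x. x \<cdot> y)"
    and linear_in_right: "Vector_Spaces.linear scale scale (\<lambda>y. x \<cdot> y)"

locale anti_flexible_algebra = bilinear_product scale mult
  for scale :: "'k::field \<Rightarrow> 'a::ab_group_add \<Rightarrow> 'a"
    and mult :: "'a \<Rightarrow> 'a \<Rightarrow> 'a"  (infixl "\<cdot>" 70) +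
  assumes anti_flexible:
    "(x \<cdot> y) \<cdot> z - x \<cdot> (y \<cdot> z) = (z \<cdot> y) \<cdot> x - z \<cdot> (y \<cdot> x)"

locale rota_baxter_operator =
  anti_flexible_algebra scale mult + Vector_Spaces.linear scale scale R
  for scale :: "'k::field \<Rightarrow> 'a::ab_group_add \<Rightarrow> 'a"
    and mult :: "'a \<Rightarrow> 'a \<Rightarrow> 'a"  (infixl "\<cdot>" 70)
    and weight :: 'k
    and R :: "'a \<Rightarrow> 'a" +
  assumes rota_baxter:
    "R a \<cdot> R b = R (a \<cdot> R b + R a \<cdot> b) + scale weight (R (a \<cdot> b))"

locale pre_anti_flexible_algebra =
  prec: bilinear_product scale prec + succ: bilinear_product scale succ
  for scale :: "'k::field \<Rightarrow> 'a::ab_group_add \<Rightarrow> 'a"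
    and prec :: "'a \<Rightarrow> 'a \<Rightarrow> 'a"  (infixl "\<prec>" 70)
    and succ :: "'a \<Rightarrow> 'a \<Rightarrow> 'a"  (infixl "\<succ>" 70) +
  assumes pre_anti_flexible_1:
    "(x \<succ> y) \<prec> z - x \<succ> (y \<prec> z) = (z \<succ> y) \<prec> x - z \<succ> (y \<prec> x)"
    and pre_anti_flexible_2:
    "(x \<succ> y + x \<prec> y) \<succ> z - x \<succ> (y \<succ> z)
      = (z \<prec> y) \<prec> x - z \<prec> (y \<prec> x + y \<succ> x)"

end

theory Submission
  imports Defs
begin

text \<open>
  Write \<open>(x,y,z)\<close> for the associator and \<open>m = \<lambda>/2\<close>. The Rota-Baxter identity says
  \<open>R (a \<prec> b + a \<succ> b) = R a \<cdot> R b\<close>, so both sides of each pre-anti-flexible axiom expand into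
  associators of \<open>x, y, z\<close> with \<open>R\<close> applied to some arguments. Anti-flexibility cancels them all,
  except that in the second axiom the terms in \<open>m\<^sup>2\<close> occur with uneven multiplicities: its two
  sides differ by \<open>m\<^sup>2 ((x \<cdot> y) \<cdot> z + z \<cdot> (y \<cdot> x))\<close>.
\<close>

context bilinear_product
begin

lemma mult_add_left: "(x + y) \<cdot> z = x \<cdot> z + y \<cdot> z"
  using Vector_Spaces.linear.axioms(3)[OF linear_in_left] by (rule module_hom.add)

lemma mult_add_right: "x \<cdot> (y + z) = x \<cdot> y + x \<cdot> z"
  using Vector_Spaces.linear.axioms(3)[OF linear_in_right] by (rule module_hom.add)

lemma mult_scale_left: "scale c x \<cdot> y = scale c (x \<cdot> y)"
  using Vector_Spaces.linear.axioms(3)[OF linear_in_left] by (rule module_hom.scale)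

lemma mult_scale_right: "x \<cdot> scale c y = scale c (x \<cdot> y)"
  using Vector_Spaces.linear.axioms(3)[OF linear_in_right] by (rule module_hom.scale)

lemmas mult_simps = mult_add_left mult_add_right mult_scale_left mult_scale_right

lemma bilinear_productI:
  assumes "\<And>x y z. f (x + y) z = f x z + f y z" "\<And>x y z. f x (y + z) = f x y + f x z"
    and "\<And>c x y. f (scale c x) y = scale c (f x y)" "\<And>c x y. f x (scale c y) = scale c (f x y)"
  shows "bilinear_product scale f"
  using assms by unfold_locales (simp_all add: Vector_Spaces.linear_iff vector_space_axioms)

end

text \<open>Fixing \<open>m\<close> with \<open>weight = m + m\<close> keeps division out of the
  calculations; characteristic different from 2 enters only when \<open>m\<close> is taken to be
  \<open>weight / 2\<close>.\<close>

locale halved_rota_baxter_operator = rota_baxter_operator +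
  fixes m
  assumes half: "weight = m + m"
begin

definition prec  (infixl "\<prec>" 70) where "a \<prec> b = a \<cdot> R b + scale m (a \<cdot> b)"

definition succ  (infixl "\<succ>" 70) where "a \<succ> b = R a \<cdot> b + scale m (a \<cdot> b)"

lemmas expand = prec_def succ_def add scale mult_simps scale_right_distrib scale_left_distrib

lemma bilinear_prec: "bilinear_product scale (\<prec>)"
  by (rule bilinear_productI) (simp_all add: expand scale_left_commute algebra_simps)

lemma bilinear_succ: "bilinear_product scale (\<succ>)"
  by (rule bilinear_productI) (simp_all add: expand scale_left_commute algebra_simps)

lemma R_prec_succ: "R (a \<prec> b + a \<succ> b) = R a \<cdot> R b"
  unfolding rota_baxter half scale_left_distrib by (simp add: expand add_ac)

text \<open>In this form the effect of swapping \<open>x\<close> and \<open>z\<close> is visible: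
  anti-flexibility preserves the first and last associators and exchanges the two middle
  ones.\<close>

lemma associator_prec_succ_left:
  "(x \<succ> y) \<prec> z - x \<succ> (y \<prec> z) =
    ((R x \<cdot> y) \<cdot> R z - R x \<cdot> (y \<cdot> R z)) + scale m ((x \<cdot> y) \<cdot> R z - x \<cdot> (y \<cdot> R z))
    + scale m ((R x \<cdot> y) \<cdot> z - R x \<cdot> (y \<cdot> z))
    + scale m (scale m ((x \<cdot> y) \<cdot> z - x \<cdot> (y \<cdot> z)))"
  by (simp add: expand scale_right_diff_distrib algebra_simps)

lemma pre_anti_flexible_first:
  "(x \<succ> y) \<prec> z - x \<succ> (y \<prec> z) = (z \<succ> y) \<prec> x - z \<succ> (y \<prec> x)"
  unfolding associator_prec_succ_left
    anti_flexible[of "R x" y "R z"] anti_flexible[of x y "R z"]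
    anti_flexible[of "R x" y z] anti_flexible[of x y z]
  by (simp add: add_ac)

text \<open>The product \<open>(x \<cdot> y) \<cdot> z\<close> arises once from each of
  \<open>\<prec>\<close> and \<open>\<succ>\<close>, but \<open>x \<cdot> (y \<cdot> z)\<close> only
  once, so one copy is left outside the associator.\<close>

lemma succ_succ_defect:
  "(x \<succ> y + x \<prec> y) \<succ> z - x \<succ> (y \<succ> z) =
    ((R x \<cdot> R y) \<cdot> z - R x \<cdot> (R y \<cdot> z)) + scale m ((R x \<cdot> y) \<cdot> z - R x \<cdot> (y \<cdot> z))
    + scale m ((x \<cdot> R y) \<cdot> z - x \<cdot> (R y \<cdot> z))
    + scale m (scale m ((x \<cdot> y) \<cdot> z - x \<cdot> (y \<cdot> z))) + scale m (scale m ((x \<cdot> y) \<cdot> z))"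
proof -
  \<comment> \<open>Only the outer \<open>\<succ>\<close> is unfolded, so that \<open>R\<close> of
    the whole sum collapses before the inner products are expanded.\<close>
  have "(x \<succ> y + x \<prec> y) \<succ> z = (R x \<cdot> R y) \<cdot> z + scale m ((x \<prec> y + x \<succ> y) \<cdot> z)"
    by (simp only: add.commute[of "x \<succ> y"] succ_def[of "x \<prec> y + x \<succ> y"] R_prec_succ)
  then show ?thesis
    by (simp add: expand scale_right_diff_distrib algebra_simps)
qed

text \<open>Mirror image: here \<open>z \<cdot> (y \<cdot> x)\<close> occurs twice, under a minus
  sign.\<close>

lemma prec_prec_defect:
  "(z \<prec> y) \<prec> x - z \<prec> (y \<prec> x + y \<succ> x) =
    ((z \<cdot> R y) \<cdot> R x - z \<cdot> (R y \<cdot> R x)) + scale m ((z \<cdot> y) \<cdot> R x - z \<cdot> (y \<cdot> R x))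
    + scale m ((z \<cdot> R y) \<cdot> x - z \<cdot> (R y \<cdot> x))
    + scale m (scale m ((z \<cdot> y) \<cdot> x - z \<cdot> (y \<cdot> x))) - scale m (scale m (z \<cdot> (y \<cdot> x)))"
proof -
  have "z \<prec> (y \<prec> x + y \<succ> x) = z \<cdot> (R y \<cdot> R x) + scale m (z \<cdot> (y \<prec> x + y \<succ> x))"
    by (simp only: prec_def[of z "y \<prec> x + y \<succ> x"] R_prec_succ)
  then show ?thesis
    by (simp add: expand scale_right_diff_distrib algebra_simps)
qed

text \<open>The four associators agree pairwise by anti-flexibility; the two surplus terms have
  opposite signs, so subtraction adds them.\<close>

lemma pre_anti_flexible_second_defect:
  "(x \<succ> y + x \<prec> y) \<succ> z - x \<succ> (y \<succ> z) - ((z \<prec> y) \<prec> x - z \<prec> (y \<prec> x + y \<succ> x))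
    = scale (m\<^sup>2) ((x \<cdot> y) \<cdot> z + z \<cdot> (y \<cdot> x))"
  unfolding succ_succ_defect prec_prec_defect
    anti_flexible[of "R x" "R y" z] anti_flexible[of "R x" y z]
    anti_flexible[of x "R y" z] anti_flexible[of x y z]
  by (simp add: power2_eq_square scale_right_distrib)

text \<open>Bilinearity and the first axiom always hold, so everything rests on the vanishing of the
  second defect.\<close>

lemma pre_anti_flexible_iff:
  "pre_anti_flexible_algebra scale (\<prec>) (\<succ>)
    \<longleftrightarrow> (\<forall>x y z. scale (m\<^sup>2) ((x \<cdot> y) \<cdot> z + z \<cdot> (y \<cdot> x)) = 0)"
  unfolding pre_anti_flexible_second_defect[symmetric] right_minus_eq
    pre_anti_flexible_algebra_def pre_anti_flexible_algebra_axioms_def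
  using bilinear_prec bilinear_succ pre_anti_flexible_first by blast

end

lemma two_neq_zero_if_CHAR_neq_2:
  assumes "CHAR('k::field) \<noteq> 2"
  shows "(2 :: 'k) \<noteq> 0"
proof
  assume "(2 :: 'k) = 0"
  then have "CHAR('k) dvd 2"
    using of_nat_eq_0_iff_char_dvd[where 'a = 'k, of 2] by simp
  then have "CHAR('k) \<noteq> 0" "CHAR('k) \<le> 2"
    by (metis dvd_0_left_iff zero_neq_numeral, metis dvd_imp_le zero_less_numeral)
  with assms CHAR_not_1[where 'a = 'k] show False
    by linarith
qed

theorem theorem2p8:
  fixes scale :: "'k::field \<Rightarrow> 'a::ab_group_add \<Rightarrow> 'a"
    and mult :: "'a \<Rightarrow> 'a \<Rightarrow> 'a"  (infixl "\<cdot>" 70)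
    and weight :: 'k
    and R :: "'a \<Rightarrow> 'a"
  assumes "CHAR('k) \<noteq> 2"
    and "anti_flexible_algebra scale mult"
    and "rota_baxter_operator scale mult weight R"
  shows "pre_anti_flexible_algebra scale
           (\<lambda>a b. a \<cdot> R b + scale (weight / 2) (a \<cdot> b))
           (\<lambda>a b. R a \<cdot> b + scale (weight / 2) (a \<cdot> b))
         \<longleftrightarrow> (\<forall>a b c. scale (weight\<^sup>2) ((a \<cdot> b) \<cdot> c + c \<cdot> (b \<cdot> a)) = 0)"
proof -
  have two: "(2 :: 'k) \<noteq> 0"
    using assms(1) by (rule two_neq_zero_if_CHAR_neq_2)
  interpret rota_baxter_operator scale mult weight R by fact
  interpret halved_rota_baxter_operator scale mult weight R "weight / 2"
    using two by unfold_locales (simp flip: mult_2)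
  have "prec = (\<lambda>a b. a \<cdot> R b + scale (weight / 2) (a \<cdot> b))"
    "succ = (\<lambda>a b. R a \<cdot> b + scale (weight / 2) (a \<cdot> b))"
    by (simp_all add: fun_eq_iff prec_def succ_def)
  then show ?thesis
    \<comment> \<open>A scaled vector is zero iff the scalar or the vector is, and
      \<open>weight / 2\<close> vanishes exactly when \<open>weight\<close> does.\<close>
    using pre_anti_flexible_iff two by (simp add: scale_eq_0_iff)
qed

end
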